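(* Let $\mathcal{H}$ be a complex Hilbert space and let $A,S,T\in\mathbb{B}(\mathcal{H})$ be such that $A$ is positive contractive. Then \[ \omega(SAT)\le \frac14\big\||T|^2+|S^*|^2\big\|+\frac12\,\omega(ST). \] Moreover, \[ \|SAT\|\le \frac{\|T\|\,\|S\|+\|ST\|}{2}. \] In particular, \[ \omega(ST)\le \frac12\big\||T|^2+|S^*|^2\big\|. \]
   Context: $\mathbb{B}(\mathcal{H})$ is the algebra of all bounded linear operators on $\mathcal{H}$. For $X\in\mathbb{B}(\mathcal{H})$, $|X|=(X^*X)^{1/2}$, the numerical radius is $\omega(X)=\sup_{\|x\|=1}|\langle Xx,x\rangle|$ and the operator norm is $\|X\|=\sup_{\|x\|=1}\|Xx\|$. An operator $A\in\mathbb{B}(\mathcal{H})$ is positive ($A\ge0$) if $\langle Ax,x\rangle\ge0$ for all $x\in\mathcal{H}$; for self-adjoint $A,B$, $A\le B$ means $B-A\ge0$. $A$ is positive contractive if $0\le A\le I$, where $I$ is the identity operator. *)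

theory Defs
  imports "HOL-Analysis.Analysis"
begin

text \<open>
  The inner product is linear in its first argument. Building on \<^class>\<open>real_normed_vector\<close>
  makes the library's bounded operators \<^typ>\<open>'a \<Rightarrow>\<^sub>L 'b\<close> available; the axioms
  \<open>scaleC_of_real\<close> and \<open>cinner_self\<close> say that the real structure and the norm are the ones
  induced by the complex structure and the inner product. Definiteness of the inner product
  follows from \<open>cinner_self\<close>.
\<close>

class complex_inner = real_normed_vector +
  fixes scaleC :: "complex \<Rightarrow> 'a \<Rightarrow> 'a"  (infixr "*\<^sub>C" 75)
    and cinner :: "'a \<Rightarrow> 'a \<Rightarrow> complex"
  assumes scaleC_add_right: "c *\<^sub>C (x + y) = c *\<^sub>C x + c *\<^sub>C y"
    and scaleC_add_left: "(c + d) *\<^sub>C x = c *\<^sub>C x + d *\<^sub>C x"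
    and scaleC_scaleC: "c *\<^sub>C (d *\<^sub>C x) = (c * d) *\<^sub>C x"
    and scaleC_of_real: "complex_of_real r *\<^sub>C x = r *\<^sub>R x"
    and cinner_commute: "cinner x y = cnj (cinner y x)"
    and cinner_add_left: "cinner (x + y) z = cinner x z + cinner y z"
    and cinner_scaleC_left: "cinner (c *\<^sub>C x) y = c * cinner x y"
    and cinner_self: "cinner x x = complex_of_real ((norm x)\<^sup>2)"

class complex_hilbert_space = complex_inner + banach

text \<open>
  \<^typ>\<open>'a \<Rightarrow>\<^sub>L 'a\<close> consists of all bounded real-linear operators with the operator norm as
  \<^const>\<open>norm\<close>; the algebra of bounded operators of the complex space is its complex-linear part.
\<close>

definition bounded_ops :: "('a::complex_inner \<Rightarrow>\<^sub>L 'a) set" where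
  "bounded_ops = {X :: 'a \<Rightarrow>\<^sub>L 'a. \<forall>c x. X (c *\<^sub>C x) = c *\<^sub>C X x}"

text \<open>
  On a \<^class>\<open>complex_hilbert_space\<close> the description in \<open>adj\<close> is met by exactly one operator
  for every member of \<open>bounded_ops\<close>, and that in \<open>op_sqrt\<close> below for every positive operator.
\<close>

definition adj :: "('a::complex_inner \<Rightarrow>\<^sub>L 'a) \<Rightarrow> ('a \<Rightarrow>\<^sub>L 'a)" where
  "adj X = (THE Y. Y \<in> bounded_ops \<and> (\<forall>x y. cinner (X x) y = cinner x (Y y)))"

definition positive_op :: "('a::complex_inner \<Rightarrow>\<^sub>L 'a) \<Rightarrow> bool" where
  "positive_op A \<longleftrightarrow> A \<in> bounded_ops \<and> (\<forall>x. cinner (A x) x \<in> \<real>\<^sub>\<ge>\<^sub>0)"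

definition op_le :: "('a::complex_inner \<Rightarrow>\<^sub>L 'a) \<Rightarrow> ('a \<Rightarrow>\<^sub>L 'a) \<Rightarrow> bool" where
  "op_le A B \<longleftrightarrow> positive_op (B - A)"

definition positive_contractive :: "('a::complex_inner \<Rightarrow>\<^sub>L 'a) \<Rightarrow> bool" where
  "positive_contractive A \<longleftrightarrow> op_le 0 A \<and> op_le A id_blinfun"

definition op_sqrt :: "('a::complex_inner \<Rightarrow>\<^sub>L 'a) \<Rightarrow> ('a \<Rightarrow>\<^sub>L 'a)" where
  "op_sqrt X = (THE P. positive_op P \<and> P o\<^sub>L P = X)"

definition op_abs :: "('a::complex_inner \<Rightarrow>\<^sub>L 'a) \<Rightarrow> ('a \<Rightarrow>\<^sub>L 'a)" where
  "op_abs X = op_sqrt (adj X o\<^sub>L X)"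

text \<open>
  The values are nonnegative, so inserting 0 changes the supremum only for the zero space, which has
  no unit vectors and whose numerical radius is 0 by convention (as is its operator norm).
\<close>

definition numerical_radius :: "('a::complex_inner \<Rightarrow>\<^sub>L 'a) \<Rightarrow> real" where
  "numerical_radius X = Sup (insert 0 {cmod (cinner (X x) x) | x. norm x = 1})"

end

theory Submission
  imports Defs
begin

text \<open>
  Put \<open>R = 2A - I\<close>. Since \<open>0 \<le> A \<le> I\<close>, the operator \<open>R\<close> is a contraction
  (\<open>norm_reflection_le\<close>), and
  \[ SAT = \frac12\, SRT + \frac12\, ST . \]
  The norm inequality is the triangle inequality for this splitting. For the numerical radius,
  any contraction \<open>R\<close> and unit vector \<open>x\<close> satisfy
  \[ |\langle SRTx, x\rangle| = |\langle RTx, S^*x\rangle| \le \|Tx\|\,\|S^*x\|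
     \le \frac12\bigl(\|Tx\|^2 + \|S^*x\|^2\bigr)
     = \frac12\bigl\langle (|T|^2 + |S^*|^2)x, x\bigr\rangle , \]
  which is at most half the norm of \<open>|T|\<^sup>2 + |S\<^sup>*|\<^sup>2\<close> (\<open>cmod_cinner_sandwich_le\<close>). With
  \<open>R = 2A - I\<close> this bounds the first summand of \<open>SAT\<close>; with \<open>R = I\<close> it is the bound
  for \<open>ST\<close> alone.

  The last equality in the display uses \<open>|X|\<^sup>2 = X\<^sup>*X\<close>. As adjoints and square roots are
  definite descriptions, this needs the existence and uniqueness of both. Adjoints come from the
  Riesz representation theorem, proved by minimising \<open>\<parallel>x\<parallel>\<^sup>2 - 2 g(x)\<close> for a bounded real
  functional \<open>g\<close>. The square root of \<open>A\<close> with \<open>0 \<le> A \<le> I\<close> is \<open>I - Y\<close>, where \<open>Y\<close>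
  is the limit of the iteration \<open>Y \<leftarrow> (I - A + Y\<^sup>2)/2\<close>; this converges in operator norm
  because it is dominated by the scalar iteration \<open>y \<leftarrow> (1 + y\<^sup>2)/2\<close>. The limit commutes with
  everything that commutes with \<open>A\<close>, and commuting positive square roots coincide.
\<close>

section \<open>The complex inner product\<close>

lemma cinner_add_right: "cinner x (y + z) = cinner x y + cinner x z"
  by (metis cinner_add_left cinner_commute complex_cnj_add)

lemma cinner_scaleC_right: "cinner x (c *\<^sub>C y) = cnj c * cinner x y"
  by (metis cinner_scaleC_left cinner_commute complex_cnj_mult)

lemma cinner_scaleR_left: "cinner (r *\<^sub>R x) y = of_real r * cinner x y"
  by (metis cinner_scaleC_left scaleC_of_real)

lemma cinner_scaleR_right: "cinner x (r *\<^sub>R y) = of_real r * cinner x y"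
  by (metis cinner_scaleC_right scaleC_of_real complex_cnj_complex_of_real)

lemma cinner_minus_left: "cinner (- x) y = - cinner x y"
  using cinner_scaleR_left[of "-1" x y] by simp

lemma cinner_minus_right: "cinner x (- y) = - cinner x y"
  using cinner_scaleR_right[of x "-1" y] by simp

lemma cinner_diff_left: "cinner (x - y) z = cinner x z - cinner y z"
  using cinner_add_left[of x "- y" z] by (simp add: cinner_minus_left)

lemma cinner_diff_right: "cinner x (y - z) = cinner x y - cinner x z"
  using cinner_add_right[of x y "- z"] by (simp add: cinner_minus_right)

lemma cinner_zero_left [simp]: "cinner 0 x = 0"
  using cinner_diff_left[of 0 0 x] by simp

lemma cinner_zero_right [simp]: "cinner x 0 = 0"
  using cinner_diff_right[of x 0 0] by simp

lemmas cinner_simps = cinner_add_left cinner_add_right cinner_diff_left cinner_diff_right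
  cinner_scaleR_left cinner_scaleR_right cinner_scaleC_left cinner_scaleC_right

lemma cinner_left_ext: "(\<And>z. cinner z x = cinner z y) \<Longrightarrow> x = y"
proof -
  assume "\<And>z. cinner z x = cinner z y"
  then have "cinner (x - y) (x - y) = 0"
    by (simp add: cinner_diff_right)
  then show "x = y"
    by (simp add: cinner_self)
qed

lemma norm_scaleC: "norm (c *\<^sub>C x) = cmod c * norm x"
proof -
  have "complex_of_real ((norm (c *\<^sub>C x))\<^sup>2) = (c * cnj c) * of_real ((norm x)\<^sup>2)"
    by (simp only: cinner_self[symmetric] cinner_scaleC_left cinner_scaleC_right mult_ac)
  also have "\<dots> = complex_of_real ((cmod c * norm x)\<^sup>2)"
    by (simp only: complex_norm_square[symmetric] power_mult_distrib of_real_mult)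
  finally have "(norm (c *\<^sub>C x))\<^sup>2 = (cmod c * norm x)\<^sup>2"
    using of_real_eq_iff by blast
  then show ?thesis
    by (simp add: power2_eq_iff_nonneg)
qed

lemma bounded_linear_scaleC: "bounded_linear (\<lambda>x. c *\<^sub>C x)"
proof (rule bounded_linear_intro)
  show "c *\<^sub>C (x + y) = c *\<^sub>C x + c *\<^sub>C y" for x y :: 'a
    by (rule scaleC_add_right)
  show "c *\<^sub>C (r *\<^sub>R x) = r *\<^sub>R (c *\<^sub>C x)" for r and x :: 'a
    by (metis scaleC_of_real scaleC_scaleC mult.commute)
  show "norm (c *\<^sub>C x) \<le> norm x * cmod c" for x :: 'a
    by (simp add: norm_scaleC)
qed

section \<open>Positive operators and the Cauchy-Schwarz inequality\<close>

text \<open>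
  The leading coefficient may vanish, as happens for forms that are only semidefinite. For
  \<open>a = 0\<close> the conclusion \<open>b = 0\<close> is the first-order condition at a minimum.
\<close>

lemma nonneg_quadratic_discriminant:
  fixes a b c :: real
  assumes "\<And>t. a + 2 * b * t + c * t\<^sup>2 \<ge> 0"
  shows "b\<^sup>2 \<le> a * c"
proof (cases "c = 0")
  case True
  have "b = 0"
  proof (rule ccontr)
    assume "b \<noteq> 0"
    then show False
      using assms[of "- (a + 1) / (2 * b)"] True by simp
  qed
  then show ?thesis using True by simp
next
  case False
  \<comment> \<open>Adding the values at \<open>t\<close> and \<open>-t\<close> removes the linear term, so \<open>c < 0\<close> fails for large \<open>t\<close>.\<close>
  have "c > 0"
  proof (rule ccontr)
    assume "\<not> c > 0"
    with False have c: "c < 0" by simp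
    define t where "t = (\<bar>a\<bar> + 1) / \<bar>c\<bar> + 1"
    have "a + c * t\<^sup>2 \<ge> 0"
      using assms[of t] assms[of "- t"] by simp
    moreover have "1 \<le> t"
      by (simp add: t_def)
    then have "t \<le> t\<^sup>2"
      by (rule self_le_power) simp
    then have "c * t\<^sup>2 \<le> c * t"
      using c by simp
    moreover have "c * t = - (\<bar>a\<bar> + 1) + c"
      using c by (simp add: t_def field_simps)
    ultimately show False using c by simp
  qed
  moreover have "a + 2 * b * (- b / c) + c * (- b / c)\<^sup>2 = a - b\<^sup>2 / c"
    using False by (simp add: field_simps power2_eq_square)
  ultimately have "0 < c" and "b\<^sup>2 / c \<le> a"
    using assms[of "- b / c"] by simp_all
  then show ?thesis
    by (simp add: pos_divide_le_eq)
qed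

text \<open>
  The self-adjoint operators, described without \<^const>\<open>adj\<close> so that they are available before
  adjoints are known to exist.
\<close>

definition symmetric_op :: "('a::complex_inner \<Rightarrow>\<^sub>L 'a) \<Rightarrow> bool" where
  "symmetric_op X \<longleftrightarrow> X \<in> bounded_ops \<and> (\<forall>x y. cinner (X x) y = cinner x (X y))"

lemma bounded_ops_scaleC: "X \<in> bounded_ops \<Longrightarrow> X (c *\<^sub>C x) = c *\<^sub>C X x"
  by (simp add: bounded_ops_def)

lemma symmetric_op_cinner: "symmetric_op X \<Longrightarrow> cinner (X x) y = cinner x (X y)"
  by (simp add: symmetric_op_def)

text \<open>
  Polarisation, which relies on the complex scalars: the reality of the quadratic form at \<open>x + y\<close>
  compares the imaginary parts of the two mixed terms, and at \<open>x + \<i>y\<close> the real parts.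
\<close>

lemma positive_op_symmetric:
  assumes "positive_op A"
  shows "symmetric_op A"
  unfolding symmetric_op_def
proof (intro conjI allI)
  show A: "A \<in> bounded_ops"
    using assms by (simp add: positive_op_def)
  fix x y
  have im: "Im (cinner (A z) z) = 0" for z
    using assms by (auto simp: positive_op_def complex_nonneg_Reals_iff)
  have 1: "Im (cinner (A x) y) + Im (cinner (A y) x) = 0"
    using im[of "x + y"] im[of x] im[of y] by (simp add: blinfun.add_right cinner_simps)
  have 2: "Re (cinner (A y) x) - Re (cinner (A x) y) = 0"
    using im[of "x + \<i> *\<^sub>C y"] im[of x] im[of y]
    by (simp add: blinfun.add_right cinner_simps bounded_ops_scaleC[OF A])
  have "cinner (A x) y = cnj (cinner (A y) x)"
    using 1 2 by (simp add: complex_eq_iff)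
  then show "cinner (A x) y = cinner x (A y)"
    by (metis cinner_commute)
qed

lemma positive_op_Re_nonneg: "positive_op A \<Longrightarrow> Re (cinner (A x) x) \<ge> 0"
  by (auto simp: positive_op_def complex_nonneg_Reals_iff)

lemma positive_opI:
  assumes "symmetric_op A" and "\<And>x. Re (cinner (A x) x) \<ge> 0"
  shows "positive_op A"
proof -
  have "Im (cinner (A x) x) = 0" for x
    using assms(1) cinner_commute[of "A x" x] symmetric_op_cinner[of A x x]
    by (simp add: complex_eq_iff)
  then show ?thesis
    using assms by (auto simp: positive_op_def symmetric_op_def complex_nonneg_Reals_iff)
qed

text \<open>
  The quadratic form of \<open>A\<close> is nonnegative along the line \<open>x + t s y\<close>, where the direction
  \<open>s = \<langle>Ax, y\<rangle>\<close> makes the mixed term a real multiple of \<open>t\<close>.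
\<close>

lemma positive_op_Cauchy_Schwarz:
  assumes "positive_op A"
  shows "(cmod (cinner (A x) y))\<^sup>2 \<le> Re (cinner (A x) x) * Re (cinner (A y) y)"
proof -
  let ?s = "cinner (A x) y"
  let ?a = "Re (cinner (A x) x)" and ?b = "Re (cinner (A y) y)" and ?m = "(cmod ?s)\<^sup>2"
  have A: "A \<in> bounded_ops"
    using assms by (simp add: positive_op_def)
  have sym: "cinner (A y) x = cnj ?s"
    by (metis assms positive_op_symmetric symmetric_op_cinner cinner_commute)
  have "?a + 2 * ?m * t + (?m * ?b) * t\<^sup>2 \<ge> 0" for t :: real
  proof -
    have "0 \<le> Re (cinner (A (x + (of_real t * ?s) *\<^sub>C y)) (x + (of_real t * ?s) *\<^sub>C y))"
      by (rule positive_op_Re_nonneg[OF assms])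
    also have "cinner (A (x + (of_real t * ?s) *\<^sub>C y)) (x + (of_real t * ?s) *\<^sub>C y)
      = cinner (A x) x + of_real (2 * t) * (?s * cnj ?s)
          + of_real (t\<^sup>2) * (?s * cnj ?s) * cinner (A y) y"
      by (simp add: blinfun.add_right cinner_simps bounded_ops_scaleC[OF A] sym
          algebra_simps power2_eq_square)
    also have "Re \<dots> = ?a + 2 * ?m * t + (?m * ?b) * t\<^sup>2"
      unfolding complex_norm_square[symmetric] by (simp flip: of_real_power)
    finally show ?thesis .
  qed
  then have "?m\<^sup>2 \<le> ?a * (?m * ?b)"
    by (rule nonneg_quadratic_discriminant)
  \<comment> \<open>One factor \<open>|s|\<^sup>2\<close> comes from the choice of direction and is cancelled.\<close>
  then have le: "?m * ?m \<le> ?m * (?a * ?b)"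
    by (simp add: power2_eq_square mult_ac)
  show ?thesis
  proof (cases "?m = 0")
    case True
    then show ?thesis
      using positive_op_Re_nonneg[OF assms, of x] positive_op_Re_nonneg[OF assms, of y] by simp
  next
    case False
    then have "0 < ?m" by simp
    with le show ?thesis
      by (simp only: mult_le_cancel_left_pos)
  qed
qed

lemma symmetric_op_id: "symmetric_op id_blinfun"
  by (simp add: symmetric_op_def bounded_ops_def)

lemma symmetric_op_add: "symmetric_op X \<Longrightarrow> symmetric_op Y \<Longrightarrow> symmetric_op (X + Y)"
  by (simp add: symmetric_op_def bounded_ops_def blinfun.add_left cinner_simps scaleC_add_right)

lemma symmetric_op_scaleR: "symmetric_op X \<Longrightarrow> symmetric_op (r *\<^sub>R X)"
  by (simp add: symmetric_op_def bounded_ops_def blinfun.scaleR_left cinner_simps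
      linear_simps(5)[OF bounded_linear_scaleC])

lemma symmetric_op_diff: "symmetric_op X \<Longrightarrow> symmetric_op Y \<Longrightarrow> symmetric_op (X - Y)"
  using symmetric_op_add[of X "(-1) *\<^sub>R Y"] symmetric_op_scaleR[of Y "-1"] by simp

lemma symmetric_op_zero: "symmetric_op 0"
  using symmetric_op_scaleR[OF symmetric_op_id, of 0] by simp

lemma symmetric_op_square: "symmetric_op X \<Longrightarrow> symmetric_op (X o\<^sub>L X)"
  by (simp add: symmetric_op_def bounded_ops_def)

lemma positive_op_id: "positive_op id_blinfun"
  by (rule positive_opI[OF symmetric_op_id]) (simp add: cinner_self)

lemma positive_op_scaleR:
  assumes "positive_op A" and "0 \<le> r"
  shows "positive_op (r *\<^sub>R A)"
proof (rule positive_opI)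
  show "symmetric_op (r *\<^sub>R A)"
    using assms(1) positive_op_symmetric symmetric_op_scaleR by blast
  show "Re (cinner ((r *\<^sub>R A) x) x) \<ge> 0" for x
    using positive_op_Re_nonneg[OF assms(1), of x] assms(2)
    by (simp add: blinfun.scaleR_left cinner_simps)
qed

lemma cinner_Cauchy_Schwarz: "cmod (cinner x y) \<le> norm x * norm y"
proof -
  have "(cmod (cinner x y))\<^sup>2 \<le> (norm x * norm y)\<^sup>2"
    using positive_op_Cauchy_Schwarz[OF positive_op_id, of x y]
    by (simp add: cinner_self power_mult_distrib)
  then show ?thesis
    by (rule power2_le_imp_le) simp
qed

lemma bounded_bilinear_cinner: "bounded_bilinear cinner"
  by unfold_locales
    (auto simp: cinner_simps scaleR_conv_of_real intro!: exI[of _ 1] cinner_Cauchy_Schwarz)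

lemma cmod_cinner_op_le:
  fixes X :: "'a::complex_inner \<Rightarrow>\<^sub>L 'a"
  shows "cmod (cinner (X x) x) \<le> norm X * (norm x)\<^sup>2"
proof -
  have "cmod (cinner (X x) x) \<le> norm (X x) * norm x"
    by (rule cinner_Cauchy_Schwarz)
  also have "\<dots> \<le> (norm X * norm x) * norm x"
    by (intro mult_right_mono norm_blinfun) simp
  finally show ?thesis by (simp add: power2_eq_square mult.assoc)
qed

lemma positive_op_zero_iff:
  assumes "positive_op A" and "Re (cinner (A x) x) = 0"
  shows "A x = 0"
proof -
  have "(cmod (cinner (A x) (A x)))\<^sup>2 \<le> 0"
    using positive_op_Cauchy_Schwarz[OF assms(1), of x "A x"] assms(2) by simp
  then show ?thesis by (simp add: cinner_self)
qed

text \<open>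
  This is \<open>A\<^sup>2 \<le> A\<close>, from the Cauchy-Schwarz inequality for the form of \<open>A\<close> at \<open>x\<close> and \<open>Ax\<close>.
\<close>

lemma positive_contractive_norm_square_le:
  assumes "positive_op A" and "\<And>x. Re (cinner (A x) x) \<le> (norm x)\<^sup>2"
  shows "(norm (A x))\<^sup>2 \<le> Re (cinner (A x) x)"
proof (cases "A x = 0")
  case False
  let ?n = "(norm (A x))\<^sup>2"
  have "?n\<^sup>2 \<le> Re (cinner (A x) x) * Re (cinner (A (A x)) (A x))"
    using positive_op_Cauchy_Schwarz[OF assms(1), of x "A x"] 
    by (simp add: cinner_self norm_power)
  also have "\<dots> \<le> Re (cinner (A x) x) * ?n"
    using assms by (intro mult_left_mono positive_op_Re_nonneg)
  finally show ?thesis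
    using False by (simp add: power2_eq_square)
qed simp

text \<open>
  Here \<open>(2A - I)\<^sup>2 = I - 4 (A - A\<^sup>2) \<le> I\<close>.
\<close>

lemma norm_reflection_le:
  assumes "positive_op A" and "\<And>x. Re (cinner (A x) x) \<le> (norm x)\<^sup>2"
  shows "norm (2 *\<^sub>R A - id_blinfun) \<le> 1"
proof (rule norm_blinfun_bound)
  fix x
  let ?y = "(2 *\<^sub>R A - id_blinfun) x"
  have sym: "cinner x (A x) = cinner (A x) x"
    using assms(1) positive_op_symmetric symmetric_op_cinner by metis
  have "(norm ?y)\<^sup>2 = Re (cinner ?y ?y)"
    by (simp add: cinner_self)
  also have "\<dots> = 4 * Re (cinner (A x) (A x)) - 4 * Re (cinner (A x) x) + Re (cinner x x)"
    by (simp add: blinfun.diff_left blinfun.scaleR_left cinner_simps sym)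
  also have "\<dots> \<le> (norm x)\<^sup>2"
    using positive_contractive_norm_square_le[OF assms, of x] by (simp add: cinner_self)
  finally have "norm ?y \<le> norm x"
    by (rule power2_le_imp_le) simp
  then show "norm ?y \<le> 1 * norm x"
    by simp
qed simp

section \<open>The Riesz representation and adjoints\<close>

text \<open>
  The functional \<open>J(x) = \<parallel>x\<parallel>\<^sup>2 - 2 g(x)\<close> is bounded below, and by the parallelogram law its
  minimising sequences are Cauchy. At the minimum the first variation vanishes, which says that
  \<open>g\<close> is the real part of the inner product with the minimiser.
\<close>

lemma real_Riesz_representation:
  fixes g :: "'a::complex_hilbert_space \<Rightarrow> real"
  assumes "bounded_linear g"
  obtains z where "\<And>h. g h = Re (cinner h z)"
proof -
  interpret g: bounded_linear g by (rule assms)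
  define J where "J x = (norm x)\<^sup>2 - 2 * g x" for x
  define m where "m = Inf (range J)"
  obtain K where K: "\<And>x. norm (g x) \<le> norm x * K"
    using g.bounded by blast
  have lower: "J x \<ge> - K\<^sup>2" for x
  proof -
    have "(norm x - K)\<^sup>2 \<ge> 0" by simp
    then show ?thesis
      using K[of x] by (simp add: J_def power2_diff)
  qed
  have bdd: "bdd_below (range J)"
    using lower by (auto simp: bdd_below_def)
  have m_le: "m \<le> J x" for x
    unfolding m_def using bdd by (simp add: cInf_lower)
  have norm_sq: "(norm x)\<^sup>2 = Re (cinner x x)" for x :: 'a
    by (simp add: cinner_self)
  have parallelogram: "(norm (x - y))\<^sup>2 \<le> 2 * (J x - m) + 2 * (J y - m)" for x y
  proof -
    have "(norm (x - y))\<^sup>2 = 2 * (norm x)\<^sup>2 + 2 * (norm y)\<^sup>2 - (norm (x + y))\<^sup>2"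
      unfolding norm_sq by (simp add: cinner_simps)
    also have "(norm (x + y))\<^sup>2 = 4 * (norm ((1 / 2) *\<^sub>R (x + y)))\<^sup>2"
      by (simp add: power_divide)
    finally have "(norm (x - y))\<^sup>2 = 2 * J x + 2 * J y - 4 * J ((1 / 2) *\<^sub>R (x + y))"
      by (simp add: J_def g.add g.scaleR field_simps)
    then show ?thesis
      using m_le[of "(1 / 2) *\<^sub>R (x + y)"] by simp
  qed
  have "\<exists>x. J x < m + 1 / real (Suc n)" for n
    using cInf_lessD[of "range J" "m + 1 / real (Suc n)"] by (auto simp: m_def)
  then obtain X where X: "\<And>n. J (X n) < m + 1 / real (Suc n)"
    by metis
  have "Cauchy X"
  proof (rule CauchyI)
    fix e :: real
    assume "0 < e"
    then obtain N where N: "1 / real (Suc N) < e\<^sup>2 / 4"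
      using nat_approx_posE[of "e\<^sup>2 / 4"] by auto
    have "norm (X i - X j) < e" if "i \<ge> N" "j \<ge> N" for i j
    proof -
      have "1 / real (Suc i) \<le> 1 / real (Suc N)" "1 / real (Suc j) \<le> 1 / real (Suc N)"
        using that by (simp_all add: frac_le)
      then have "(norm (X i - X j))\<^sup>2 < e\<^sup>2"
        using parallelogram[of "X i" "X j"] X[of i] X[of j] N by argo
      then show ?thesis
        using \<open>0 < e\<close> by (simp add: power2_less_imp_less)
    qed
    then show "\<exists>M. \<forall>i\<ge>M. \<forall>j\<ge>M. norm (X i - X j) < e" by blast
  qed
  then obtain z where z: "X \<longlonglongrightarrow> z"
    using Cauchy_convergent_iff convergent_def by blast
  have "(\<lambda>n. J (X n)) \<longlonglongrightarrow> J z"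
    unfolding J_def by (intro tendsto_intros z g.tendsto)
  moreover have "(\<lambda>n. m + 1 / real (Suc n)) \<longlonglongrightarrow> m + 0"
    by (intro tendsto_intros LIMSEQ_Suc[OF lim_1_over_n])
  ultimately have "J z \<le> m + 0"
    by (rule LIMSEQ_le) (use X less_imp_le in blast)
  then have minimal: "J z \<le> J x" for x
    using m_le[of x] by simp
  have "g h = Re (cinner h z)" for h
  proof -
    have sym: "Re (cinner z h) = Re (cinner h z)"
      using cinner_commute[of z h] by simp
    have "0 + 2 * (Re (cinner h z) - g h) * t + (norm h)\<^sup>2 * t\<^sup>2 \<ge> 0" for t
      using minimal[of "z + t *\<^sub>R h"]
      unfolding J_def norm_sq
      by (simp add: cinner_simps g.add g.scaleR sym algebra_simps power2_eq_square)
    from nonneg_quadratic_discriminant[OF this] show ?thesis by simp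
  qed
  then show ?thesis by (rule that)
qed

text \<open>
  The values of the adjoint are Riesz representatives of \<open>x \<mapsto> \<langle>Xx, y\<rangle>\<close>. The real
  representation theorem suffices: replacing \<open>x\<close> by \<open>\<i>x\<close> turns the real part into the imaginary
  part.
\<close>

lemma adjoint_exists:
  fixes X :: "'a::complex_hilbert_space \<Rightarrow>\<^sub>L 'a"
  assumes X: "X \<in> bounded_ops"
  obtains Y where "Y \<in> bounded_ops" and "\<And>x y. cinner (X x) y = cinner x (Y y)"
proof -
  interpret ci: bounded_bilinear "cinner :: 'a \<Rightarrow> 'a \<Rightarrow> complex"
    by (rule bounded_bilinear_cinner)
  have "\<exists>z. \<forall>x. cinner (X x) y = cinner x z" for y
  proof -
    have "bounded_linear (\<lambda>x. Re (cinner (X x) y))"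
      by (intro bounded_linear_compose[OF bounded_linear_Re]
          bounded_linear_compose[OF ci.bounded_linear_left] blinfun.bounded_linear_right)
    then obtain z where z: "\<And>x. Re (cinner (X x) y) = Re (cinner x z)"
      using real_Riesz_representation by blast
    have "Im (cinner (X x) y) = Im (cinner x z)" for x
      using z[of "\<i> *\<^sub>C x"] by (simp add: bounded_ops_scaleC[OF X] cinner_simps)
    then show ?thesis
      using z by (auto simp: complex_eq_iff)
  qed
  then obtain Y where Y: "\<And>x y. cinner (X x) y = cinner x (Y y)"
    by metis
  have scaleC: "Y (c *\<^sub>C y) = c *\<^sub>C Y y" for c y
    by (rule cinner_left_ext) (simp add: cinner_scaleC_right flip: Y)
  have "bounded_linear Y"
  proof (rule bounded_linear_intro)
    show "Y (x + y) = Y x + Y y" for x y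
      by (rule cinner_left_ext) (simp add: cinner_add_right flip: Y)
    show "Y (r *\<^sub>R y) = r *\<^sub>R Y y" for r y
      using scaleC[of "of_real r" y] by (simp add: scaleC_of_real)
    show "norm (Y y) \<le> norm y * norm X" for y
    proof (cases "Y y = 0")
      case False
      have "norm (Y y) * norm (Y y) = cmod (cinner (X (Y y)) y)"
        by (simp add: Y cinner_self norm_power power2_eq_square norm_mult)
      also have "\<dots> \<le> norm (X (Y y)) * norm y"
        by (rule cinner_Cauchy_Schwarz)
      also have "\<dots> \<le> (norm X * norm (Y y)) * norm y"
        by (intro mult_right_mono norm_blinfun) simp
      finally have "norm (Y y) * norm (Y y) \<le> norm (Y y) * (norm y * norm X)"
        by (simp add: mult_ac)
      then show ?thesis
        using False by simp
    qed simp
  qed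
  then have "blinfun_apply (Blinfun Y) = Y"
    by (rule bounded_linear_Blinfun_apply)
  then show ?thesis
    using that[of "Blinfun Y"] Y scaleC by (simp add: bounded_ops_def)
qed

lemma adj_properties:
  fixes X :: "'a::complex_hilbert_space \<Rightarrow>\<^sub>L 'a"
  assumes "X \<in> bounded_ops"
  shows adj_bounded_ops: "adj X \<in> bounded_ops"
    and cinner_adj: "cinner (X x) y = cinner x (adj X y)"
proof -
  obtain Y where Y: "Y \<in> bounded_ops" "\<And>x y. cinner (X x) y = cinner x (Y y)"
    using adjoint_exists[OF assms] by blast
  have "adj X = Y"
    unfolding adj_def
  proof (rule the_equality)
    fix Z
    assume Z: "Z \<in> bounded_ops \<and> (\<forall>x y. cinner (X x) y = cinner x (Z y))"
    show "Z = Y"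
      by (intro blinfun_eqI cinner_left_ext) (metis Y(2) Z)
  qed (use Y in auto)
  then show "adj X \<in> bounded_ops" "cinner (X x) y = cinner x (adj X y)"
    using Y by auto
qed

lemma bounded_ops_compose:
  "X \<in> bounded_ops \<Longrightarrow> Y \<in> bounded_ops \<Longrightarrow> X o\<^sub>L Y \<in> bounded_ops"
  by (simp add: bounded_ops_def)

lemma cinner_adj_compose:
  fixes X :: "'a::complex_hilbert_space \<Rightarrow>\<^sub>L 'a"
  assumes "X \<in> bounded_ops"
  shows "cinner ((adj X o\<^sub>L X) x) x = of_real ((norm (X x))\<^sup>2)"
proof -
  have "cinner ((adj X o\<^sub>L X) x) x = cnj (cinner x (adj X (X x)))"
    using cinner_commute by simp
  also have "\<dots> = of_real ((norm (X x))\<^sup>2)"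
    by (simp add: cinner_self flip: cinner_adj[OF assms])
  finally show ?thesis .
qed

lemma positive_op_adj_compose:
  fixes X :: "'a::complex_hilbert_space \<Rightarrow>\<^sub>L 'a"
  assumes "X \<in> bounded_ops"
  shows "positive_op (adj X o\<^sub>L X)"
  using bounded_ops_compose[OF adj_bounded_ops[OF assms] assms] cinner_adj_compose[OF assms]
  by (auto simp: positive_op_def complex_nonneg_Reals_iff)

section \<open>The positive square root\<close>

text \<open>
  With \<open>B = I - A\<close> a fixed point \<open>Y\<close> satisfies \<open>(I - Y)\<^sup>2 = I - B = A\<close>.
\<close>

fun sqrt_iter :: "('a::real_normed_vector \<Rightarrow>\<^sub>L 'a) \<Rightarrow> nat \<Rightarrow> ('a \<Rightarrow>\<^sub>L 'a)" where
  "sqrt_iter B 0 = 0"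
| "sqrt_iter B (Suc n) = (1 / 2) *\<^sub>R (B + (sqrt_iter B n o\<^sub>L sqrt_iter B n))"

text \<open>
  The same iteration for \<open>B = 1\<close>. It increases to 1, and its values and increments dominate those
  of \<^const>\<open>sqrt_iter\<close> in norm.
\<close>

fun scalar_iter :: "nat \<Rightarrow> real" where
  "scalar_iter 0 = 0"
| "scalar_iter (Suc n) = (1 + (scalar_iter n)\<^sup>2) / 2"

lemma scalar_iter_bounds: "0 \<le> scalar_iter n \<and> scalar_iter n \<le> 1"
  by (induction n) (auto simp: power_le_one)

lemma scalar_iter_mono: "scalar_iter n \<le> scalar_iter (Suc n)"
proof -
  have "(1 - scalar_iter n)\<^sup>2 \<ge> 0" by simp
  then show ?thesis by (simp add: power2_diff)
qed

lemma sqrt_iter_norm_le: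
  assumes "norm B \<le> 1"
  shows "norm (sqrt_iter B n) \<le> scalar_iter n"
proof (induction n)
  case (Suc n)
  let ?Y = "sqrt_iter B n"
  have "norm (?Y o\<^sub>L ?Y) \<le> norm ?Y * norm ?Y"
    by (rule norm_blinfun_compose)
  also have "\<dots> \<le> (scalar_iter n)\<^sup>2"
    unfolding power2_eq_square using Suc scalar_iter_bounds[of n] by (intro mult_mono) auto
  finally show ?case
    using assms norm_triangle_ineq[of B "?Y o\<^sub>L ?Y"] by simp
qed simp

text \<open>
  The identity \<open>Z\<^sup>2 - Y\<^sup>2 = (Z - Y) Z + Y (Z - Y)\<close> holds without commutativity, and taking norms
  in it gives exactly the corresponding scalar difference.
\<close>

lemma sqrt_iter_increment_le:
  assumes "norm B \<le> 1"
  shows "norm (sqrt_iter B (Suc n) - sqrt_iter B n) \<le> scalar_iter (Suc n) - scalar_iter n"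
proof (induction n)
  case 0
  have "sqrt_iter B (Suc 0) = (1 / 2) *\<^sub>R B"
    by (intro blinfun_eqI) (simp add: blinfun.scaleR_left)
  then show ?case using assms by simp
next
  case (Suc n)
  define Y Z where "Y = sqrt_iter B n" and "Z = sqrt_iter B (Suc n)"
  define y z where "y = scalar_iter n" and "z = scalar_iter (Suc n)"
  have y: "0 \<le> y" "y \<le> z" and bounds: "norm Y \<le> y" "norm Z \<le> z" "norm (Z - Y) \<le> z - y"
    using Suc scalar_iter_bounds[of n] scalar_iter_mono[of n] sqrt_iter_norm_le[OF assms]
    unfolding Y_def Z_def y_def z_def by blast+
  have "sqrt_iter B (Suc (Suc n)) - Z
      = (1 / 2) *\<^sub>R (B + (Z o\<^sub>L Z)) - (1 / 2) *\<^sub>R (B + (Y o\<^sub>L Y))"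
    unfolding Y_def Z_def by (simp only: sqrt_iter.simps)
  also have "\<dots> = (1 / 2) *\<^sub>R (((Z - Y) o\<^sub>L Z) + (Y o\<^sub>L (Z - Y)))"
    by (rule blinfun_eqI) (simp add: blinfun.add_left blinfun.diff_left blinfun.diff_right
        blinfun.scaleR_left flip: scaleR_diff_right)
  finally have "norm (sqrt_iter B (Suc (Suc n)) - Z)
      \<le> (norm ((Z - Y) o\<^sub>L Z) + norm (Y o\<^sub>L (Z - Y))) / 2"
    using norm_triangle_ineq[of "(Z - Y) o\<^sub>L Z" "Y o\<^sub>L (Z - Y)"] by simp
  also have "norm ((Z - Y) o\<^sub>L Z) \<le> (z - y) * z"
    using norm_blinfun_compose[of "Z - Y" Z] bounds y
    by (elim order_trans, intro mult_mono) auto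
  also have "norm (Y o\<^sub>L (Z - Y)) \<le> y * (z - y)"
    using norm_blinfun_compose[of Y "Z - Y"] bounds y
    by (elim order_trans, intro mult_mono) auto
  also have "((z - y) * z + y * (z - y)) / 2 = (1 + z\<^sup>2) / 2 - (1 + y\<^sup>2) / 2"
    by (simp add: field_simps power2_eq_square)
  also have "\<dots> = scalar_iter (Suc (Suc n)) - scalar_iter (Suc n)"
    by (simp only: scalar_iter.simps y_def z_def)
  finally show ?case by (simp only: Z_def divide_right_mono add_mono)
qed

text \<open>
  The increments are dominated by those of a convergent real sequence, so their series converges
  absolutely in the Banach space of operators.
\<close>

lemma sqrt_iter_convergent:
  fixes B :: "'a::banach \<Rightarrow>\<^sub>L 'a"
  assumes "norm B \<le> 1"
  shows "convergent (sqrt_iter B)"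
proof -
  have "convergent scalar_iter"
    using scalar_iter_bounds scalar_iter_mono
    by (intro Bseq_mono_convergent BseqI'[where K = 1])
      (auto intro: lift_Suc_mono_le[of scalar_iter] simp del: scalar_iter.simps)
  then have "summable (\<lambda>n. scalar_iter (Suc n) - scalar_iter n)"
    using telescope_summable unfolding convergent_def by blast
  then have "summable (\<lambda>n. sqrt_iter B (Suc n) - sqrt_iter B n)"
    by (rule summable_comparison_test'[where N = 0]) (rule sqrt_iter_increment_le[OF assms])
  then have "convergent (\<lambda>m. \<Sum>n<m. sqrt_iter B (Suc n) - sqrt_iter B n)"
    by (simp only: summable_iff_convergent)
  then show ?thesis
    by (simp only: sum_lessThan_telescope sqrt_iter.simps(1) diff_zero)
qed

lemma symmetric_op_limit:
  assumes "\<And>n. symmetric_op (X n)" and "X \<longlonglongrightarrow> Y"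
  shows "symmetric_op Y"
proof -
  interpret sc: bounded_linear "\<lambda>x :: 'a. c *\<^sub>C x" for c
    by (rule bounded_linear_scaleC)
  interpret ci: bounded_bilinear "cinner :: 'a \<Rightarrow> 'a \<Rightarrow> complex"
    by (rule bounded_bilinear_cinner)
  have lim: "(\<lambda>n. X n x) \<longlonglongrightarrow> Y x" for x
    by (intro blinfun.tendsto assms(2) tendsto_const)
  have "Y (c *\<^sub>C x) = c *\<^sub>C Y x" for c x
  proof (rule LIMSEQ_unique[OF lim])
    show "(\<lambda>n. X n (c *\<^sub>C x)) \<longlonglongrightarrow> c *\<^sub>C Y x"
      using sc.tendsto[OF lim, of c x] assms(1) by (simp add: symmetric_op_def bounded_ops_def)
  qed
  moreover have "cinner (Y x) y = cinner x (Y y)" for x y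
  proof (rule LIMSEQ_unique)
    show "(\<lambda>n. cinner (X n x) y) \<longlonglongrightarrow> cinner (Y x) y"
      by (intro ci.tendsto lim tendsto_const)
    show "(\<lambda>n. cinner (X n x) y) \<longlonglongrightarrow> cinner x (Y y)"
      unfolding symmetric_op_cinner[OF assms(1)] by (intro ci.tendsto lim tendsto_const)
  qed
  ultimately show ?thesis
    by (simp add: symmetric_op_def bounded_ops_def)
qed

lemma sqrt_iter_symmetric: "symmetric_op B \<Longrightarrow> symmetric_op (sqrt_iter B n)"
  by (induction n) (simp_all add: symmetric_op_zero symmetric_op_add symmetric_op_scaleR
      symmetric_op_square)

lemma sqrt_iter_commute:
  assumes "C o\<^sub>L B = B o\<^sub>L C"
  shows "C o\<^sub>L sqrt_iter B n = sqrt_iter B n o\<^sub>L C"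
proof (induction n)
  case (Suc n)
  have 1: "C (B x) = B (C x)" and 2: "C (sqrt_iter B n x) = sqrt_iter B n (C x)" for x
    using assms Suc by (metis blinfun_apply_blinfun_compose)+
  show ?case
    by (rule blinfun_eqI) (simp add: blinfun.add_left blinfun.add_right blinfun.scaleR_left
        blinfun.scaleR_right 1 2)
qed (auto intro: blinfun_eqI)

text \<open>
  The limit \<open>Y\<close> of the iteration has \<open>\<parallel>Y\<parallel> \<le> 1\<close>, so \<open>I - Y\<close> is positive. The statement about
  commuting operators is recorded because the uniqueness of the square root depends on it.
\<close>

lemma contractive_sqrt_exists:
  fixes A :: "'a::complex_hilbert_space \<Rightarrow>\<^sub>L 'a"
  assumes pos: "positive_op A" and contr: "\<And>x. Re (cinner (A x) x) \<le> (norm x)\<^sup>2"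
  obtains P where "positive_op P" and "P o\<^sub>L P = A"
    and "\<And>C. C o\<^sub>L A = A o\<^sub>L C \<Longrightarrow> C o\<^sub>L P = P o\<^sub>L C"
proof -
  interpret comp: bounded_bilinear "(o\<^sub>L) :: ('a \<Rightarrow>\<^sub>L 'a) \<Rightarrow> ('a \<Rightarrow>\<^sub>L 'a) \<Rightarrow> 'a \<Rightarrow>\<^sub>L 'a"
    by (rule bounded_bilinear_blinfun_compose)
  define B where "B = id_blinfun - A"
  have symA: "symmetric_op A"
    by (rule positive_op_symmetric[OF pos])
  have symB: "symmetric_op B"
    unfolding B_def by (intro symmetric_op_diff symmetric_op_id symA)
  have norm_B: "norm B \<le> 1"
  proof (rule norm_blinfun_bound)
    fix x
    have "(norm (B x))\<^sup>2 = Re (cinner (B x) (B x))"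
      by (simp add: cinner_self)
    also have "\<dots> = (norm x)\<^sup>2 - 2 * Re (cinner (A x) x) + (norm (A x))\<^sup>2"
      unfolding B_def using symmetric_op_cinner[OF symA, of x x]
      by (simp add: blinfun.diff_left cinner_diff_left cinner_diff_right)
        (simp add: cinner_self)
    also have "\<dots> \<le> (norm x)\<^sup>2"
      using positive_contractive_norm_square_le[OF pos contr, of x]
        positive_op_Re_nonneg[OF pos, of x] by simp
    finally have "norm (B x) \<le> norm x"
      by (rule power2_le_imp_le) simp
    then show "norm (B x) \<le> 1 * norm x"
      by simp
  qed simp
  obtain Y where Y: "sqrt_iter B \<longlonglongrightarrow> Y"
    using sqrt_iter_convergent[OF norm_B] by (auto simp: convergent_def)
  have fixpoint: "Y = (1 / 2) *\<^sub>R (B + (Y o\<^sub>L Y))"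
  proof (rule LIMSEQ_unique)
    show "(\<lambda>n. sqrt_iter B (Suc n)) \<longlonglongrightarrow> Y"
      by (rule LIMSEQ_Suc[OF Y])
    show "(\<lambda>n. sqrt_iter B (Suc n)) \<longlonglongrightarrow> (1 / 2) *\<^sub>R (B + (Y o\<^sub>L Y))"
      unfolding sqrt_iter.simps by (intro tendsto_intros comp.tendsto Y)
  qed
  have norm_Y: "norm Y \<le> 1"
  proof (rule LIMSEQ_le_const2[OF tendsto_norm[OF Y]])
    have "norm (sqrt_iter B n) \<le> 1" for n
      using sqrt_iter_norm_le[OF norm_B, of n] scalar_iter_bounds[of n] by linarith
    then show "\<exists>N. \<forall>n\<ge>N. norm (sqrt_iter B n) \<le> 1" by blast
  qed
  have symY: "symmetric_op Y"
    by (rule symmetric_op_limit[OF sqrt_iter_symmetric[OF symB] Y])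
  have "positive_op (id_blinfun - Y)"
  proof (rule positive_opI)
    show "symmetric_op (id_blinfun - Y)"
      by (intro symmetric_op_diff symmetric_op_id symY)
    fix x
    have "Re (cinner (Y x) x) \<le> cmod (cinner (Y x) x)"
      by (rule complex_Re_le_cmod)
    also have "\<dots> \<le> norm Y * (norm x)\<^sup>2"
      by (rule cmod_cinner_op_le)
    also have "\<dots> \<le> 1 * (norm x)\<^sup>2"
      using norm_Y by (intro mult_right_mono) auto
    finally show "Re (cinner ((id_blinfun - Y) x) x) \<ge> 0"
      by (simp add: blinfun.diff_left cinner_simps cinner_self)
  qed
  moreover have "(id_blinfun - Y) o\<^sub>L (id_blinfun - Y) = A"
  proof (rule blinfun_eqI)
    fix x
    have "Y x = (1 / 2) *\<^sub>R (B x + Y (Y x))"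
      using arg_cong[OF fixpoint, of "\<lambda>Z. Z x"]
      by (simp add: blinfun.add_left blinfun.scaleR_left)
    then have "2 *\<^sub>R Y x = 2 *\<^sub>R (1 / 2) *\<^sub>R (B x + Y (Y x))"
      by (rule arg_cong)
    then have "Y (Y x) = 2 *\<^sub>R Y x - B x" by simp
    then show "((id_blinfun - Y) o\<^sub>L (id_blinfun - Y)) x = A x"
      by (simp add: blinfun.diff_left blinfun.diff_right B_def scaleR_2)
  qed
  moreover have "C o\<^sub>L (id_blinfun - Y) = (id_blinfun - Y) o\<^sub>L C" if "C o\<^sub>L A = A o\<^sub>L C" for C
  proof -
    have id: "C o\<^sub>L id_blinfun = id_blinfun o\<^sub>L C"
      by (auto intro: blinfun_eqI)
    then have comm_B: "C o\<^sub>L B = B o\<^sub>L C"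
      using that by (simp add: B_def comp.diff_left comp.diff_right)
    have "C o\<^sub>L Y = Y o\<^sub>L C"
    proof (rule LIMSEQ_unique)
      show "(\<lambda>n. C o\<^sub>L sqrt_iter B n) \<longlonglongrightarrow> (C o\<^sub>L Y)"
        by (intro comp.tendsto tendsto_const Y)
      show "(\<lambda>n. C o\<^sub>L sqrt_iter B n) \<longlonglongrightarrow> (Y o\<^sub>L C)"
        unfolding sqrt_iter_commute[OF comm_B] by (intro comp.tendsto tendsto_const Y)
    qed
    with id show ?thesis
      by (simp add: comp.diff_left comp.diff_right)
  qed
  ultimately show ?thesis by (rule that)
qed

lemma positive_sqrt_exists:
  fixes A :: "'a::complex_hilbert_space \<Rightarrow>\<^sub>L 'a"
  assumes pos: "positive_op A"
  obtains P where "positive_op P" and "P o\<^sub>L P = A"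
    and "\<And>C. C o\<^sub>L A = A o\<^sub>L C \<Longrightarrow> C o\<^sub>L P = P o\<^sub>L C"
proof -
  interpret comp: bounded_bilinear "(o\<^sub>L) :: ('a \<Rightarrow>\<^sub>L 'a) \<Rightarrow> ('a \<Rightarrow>\<^sub>L 'a) \<Rightarrow> 'a \<Rightarrow>\<^sub>L 'a"
    by (rule bounded_bilinear_blinfun_compose)
  \<comment> \<open>Any positive bound of \<open>\<parallel>A\<parallel>\<close> serves for scaling; the added 1 covers \<open>A = 0\<close>.\<close>
  define r where "r = norm A + 1"
  have r: "r > 0" "norm A \<le> r"
    by (simp_all add: r_def add_nonneg_pos)
  define A' where "A' = (1 / r) *\<^sub>R A"
  have A: "A = r *\<^sub>R A'"
    using r by (simp add: A'_def)
  have "positive_op A'"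
    unfolding A'_def using r by (intro positive_op_scaleR pos) simp
  moreover have "Re (cinner (A' x) x) \<le> (norm x)\<^sup>2" for x
  proof -
    have "Re (cinner (A x) x) \<le> r * (norm x)\<^sup>2"
      using complex_Re_le_cmod[of "cinner (A x) x"] cmod_cinner_op_le[of A x]
        mult_right_mono[OF r(2), of "(norm x)\<^sup>2"] by simp
    then show ?thesis
      using r by (simp add: A'_def blinfun.scaleR_left cinner_simps field_simps)
  qed
  ultimately obtain Q where Q: "positive_op Q" "Q o\<^sub>L Q = A'"
      "\<And>C. C o\<^sub>L A' = A' o\<^sub>L C \<Longrightarrow> C o\<^sub>L Q = Q o\<^sub>L C"
    by (rule contractive_sqrt_exists) blast
  show ?thesis
  proof (rule that)
    show "positive_op (sqrt r *\<^sub>R Q)"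
      using r by (intro positive_op_scaleR Q) simp
    show "(sqrt r *\<^sub>R Q) o\<^sub>L (sqrt r *\<^sub>R Q) = A"
      using r by (simp add: comp.scaleR_left comp.scaleR_right Q A)
    show "C o\<^sub>L (sqrt r *\<^sub>R Q) = (sqrt r *\<^sub>R Q) o\<^sub>L C" if "C o\<^sub>L A = A o\<^sub>L C" for C
    proof -
      have "C o\<^sub>L A' = A' o\<^sub>L C"
        using that by (simp add: A'_def comp.scaleR_left comp.scaleR_right)
      then show ?thesis
        by (simp add: comp.scaleR_left comp.scaleR_right Q)
    qed
  qed
qed

text \<open>
  For \<open>y = (P - Q) x\<close> commutativity gives \<open>(P + Q) y = (P\<^sup>2 - Q\<^sup>2) x = 0\<close>. Both forms are
  nonnegative at \<open>y\<close>, so both vanish there; hence \<open>Py = Qy = 0\<close> and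
  \<open>\<parallel>y\<parallel>\<^sup>2 = \<langle>x, (P - Q) y\<rangle> = 0\<close>.
\<close>

lemma commuting_positive_sqrt_unique:
  assumes P: "positive_op P" and Q: "positive_op Q"
    and eq: "P o\<^sub>L P = Q o\<^sub>L Q" and comm: "P o\<^sub>L Q = Q o\<^sub>L P"
  shows "P = Q"
proof (rule blinfun_eqI)
  fix x
  define y where "y = P x - Q x"
  have PP: "P (P z) = Q (Q z)" and PQ: "P (Q z) = Q (P z)" for z
    using eq comm by (metis blinfun_apply_blinfun_compose)+
  have "P y + Q y = 0"
    by (simp add: y_def blinfun.diff_right PP PQ)
  then have "Re (cinner (P y) y) + Re (cinner (Q y) y) = 0"
    by (metis cinner_add_left cinner_zero_left plus_complex.sel(1) zero_complex.sel(1))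
  then have "Re (cinner (P y) y) = 0" "Re (cinner (Q y) y) = 0"
    using positive_op_Re_nonneg[OF P, of y] positive_op_Re_nonneg[OF Q, of y] by linarith+
  then have zero: "P y = 0" "Q y = 0"
    using positive_op_zero_iff P Q by blast+
  have "cinner y y = cinner (P x) y - cinner (Q x) y"
    by (simp add: y_def cinner_diff_left)
  also have "\<dots> = 0"
    using P Q by (simp add: positive_op_symmetric symmetric_op_cinner zero)
  finally show "P x = Q x"
    by (simp add: cinner_self y_def)
qed

lemma op_sqrt_square:
  fixes A :: "'a::complex_hilbert_space \<Rightarrow>\<^sub>L 'a"
  assumes "positive_op A"
  shows "op_sqrt A o\<^sub>L op_sqrt A = A"
proof -
  obtain Q where Q: "positive_op Q" "Q o\<^sub>L Q = A"
      "\<And>C. C o\<^sub>L A = A o\<^sub>L C \<Longrightarrow> C o\<^sub>L Q = Q o\<^sub>L C"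
    using positive_sqrt_exists[OF assms] by blast
  have unique: "P = Q" if P: "positive_op P \<and> P o\<^sub>L P = A" for P
  proof (rule commuting_positive_sqrt_unique)
    \<comment> \<open>Any square root of \<open>A\<close> commutes with \<open>A\<close>, hence with the root \<open>Q\<close> just constructed.\<close>
    have "P o\<^sub>L A = A o\<^sub>L P"
      using P by (auto intro: blinfun_eqI)
    then show "P o\<^sub>L Q = Q o\<^sub>L P" by (rule Q)
  qed (use P Q(1,2) in auto)
  have "op_sqrt A = Q"
    unfolding op_sqrt_def
  proof (rule the_equality)
    show "positive_op Q \<and> Q o\<^sub>L Q = A" using Q(1,2) ..
  qed (rule unique)
  then show ?thesis using Q(2) by simp
qed

lemma op_abs_square:
  fixes X :: "'a::complex_hilbert_space \<Rightarrow>\<^sub>L 'a"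
  assumes "X \<in> bounded_ops"
  shows "op_abs X o\<^sub>L op_abs X = adj X o\<^sub>L X"
  unfolding op_abs_def by (rule op_sqrt_square[OF positive_op_adj_compose[OF assms]])

section \<open>The inequalities\<close>

lemma numerical_radius_ge:
  fixes X :: "'a::complex_inner \<Rightarrow>\<^sub>L 'a"
  assumes "norm x = 1"
  shows "cmod (cinner (X x) x) \<le> numerical_radius X"
proof -
  have "cmod (cinner (X y) y) \<le> norm X" if "norm y = 1" for y
    using cmod_cinner_op_le[of X y] that by simp
  then have "bdd_above (insert 0 {cmod (cinner (X x) x) | x. norm x = 1})"
    by (intro bdd_aboveI[of _ "norm X"]) auto
  then show ?thesis
    unfolding numerical_radius_def using assms by (intro cSup_upper) auto
qed

lemma numerical_radius_le:
  fixes X :: "'a::complex_inner \<Rightarrow>\<^sub>L 'a"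
  assumes "0 \<le> c" and "\<And>x. norm x = 1 \<Longrightarrow> cmod (cinner (X x) x) \<le> c"
  shows "numerical_radius X \<le> c"
  unfolding numerical_radius_def using assms by (intro cSup_least) auto

lemma numerical_radius_nonneg:
  fixes X :: "'a::complex_inner \<Rightarrow>\<^sub>L 'a"
  shows "0 \<le> numerical_radius X"
proof (cases "\<exists>x :: 'a. norm x = 1")
  case True
  then show ?thesis using numerical_radius_ge norm_ge_zero order_trans by metis
next
  case False
  then show ?thesis by (simp add: numerical_radius_def)
qed

lemma norm_square_sum_le:
  fixes S T :: "'a::complex_hilbert_space \<Rightarrow>\<^sub>L 'a"
  assumes S: "S \<in> bounded_ops" and T: "T \<in> bounded_ops" and x: "norm x = 1"
  shows "(norm (T x))\<^sup>2 + (norm (adj S x))\<^sup>2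
    \<le> norm ((op_abs T o\<^sub>L op_abs T) + (op_abs (adj S) o\<^sub>L op_abs (adj S)))"
proof -
  note S' = adj_bounded_ops[OF S]
  let ?M = "(op_abs T o\<^sub>L op_abs T) + (op_abs (adj S) o\<^sub>L op_abs (adj S))"
  have "cinner (?M x) x = of_real ((norm (T x))\<^sup>2 + (norm (adj S x))\<^sup>2)"
    unfolding op_abs_square[OF T] op_abs_square[OF S'] blinfun.add_left cinner_add_left
      cinner_adj_compose[OF T] cinner_adj_compose[OF S'] by simp
  then have "cmod (cinner (?M x) x) = (norm (T x))\<^sup>2 + (norm (adj S x))\<^sup>2"
    by (simp only: norm_of_real) simp
  then show ?thesis
    using cmod_cinner_op_le[of ?M x] x by simp
qed

text \<open>
  Moving \<open>S\<close> to the right-hand side as its adjoint leaves \<open>\<parallel>Tx\<parallel> \<parallel>S\<^sup>*x\<parallel>\<close>, to which the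
  inequality of the arithmetic and geometric means applies.
\<close>

lemma cmod_cinner_sandwich_le:
  fixes R S T :: "'a::complex_hilbert_space \<Rightarrow>\<^sub>L 'a"
  assumes S: "S \<in> bounded_ops" and T: "T \<in> bounded_ops" and R: "norm R \<le> 1"
    and x: "norm x = 1"
  shows "cmod (cinner (S (R (T x))) x)
    \<le> 1 / 2 * norm ((op_abs T o\<^sub>L op_abs T) + (op_abs (adj S) o\<^sub>L op_abs (adj S)))"
proof -
  let ?a = "norm (T x)" and ?b = "norm (adj S x)"
  have "cmod (cinner (S (R (T x))) x) \<le> norm (R (T x)) * ?b"
    unfolding cinner_adj[OF S] by (rule cinner_Cauchy_Schwarz)
  also have "norm (R (T x)) \<le> norm R * ?a"
    by (rule norm_blinfun)
  also have "\<dots> \<le> 1 * ?a"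
    using R by (intro mult_right_mono) auto
  finally have "cmod (cinner (S (R (T x))) x) \<le> ?a * ?b"
    by (simp add: mult_right_mono)
  also have "\<dots> \<le> 1 / 2 * (?a\<^sup>2 + ?b\<^sup>2)"
    using sum_squares_bound[of ?a ?b] by simp
  finally show ?thesis
    using norm_square_sum_le[OF S T x] by simp
qed

theorem corollary3p4:
  fixes A S T :: "'a::complex_hilbert_space \<Rightarrow>\<^sub>L 'a"
  assumes "A \<in> bounded_ops" and "S \<in> bounded_ops" and "T \<in> bounded_ops"
    and "positive_contractive A"
  shows "numerical_radius (S o\<^sub>L A o\<^sub>L T)
           \<le> 1 / 4 * norm ((op_abs T o\<^sub>L op_abs T) + (op_abs (adj S) o\<^sub>L op_abs (adj S)))
             + 1 / 2 * numerical_radius (S o\<^sub>L T)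
       \<and> norm (S o\<^sub>L A o\<^sub>L T) \<le> (norm T * norm S + norm (S o\<^sub>L T)) / 2
       \<and> numerical_radius (S o\<^sub>L T)
           \<le> 1 / 2 * norm ((op_abs T o\<^sub>L op_abs T) + (op_abs (adj S) o\<^sub>L op_abs (adj S)))"
    (is "?num_SAT \<and> ?norm_SAT \<and> ?num_ST")
proof (intro conjI)
  note S = assms(2) and T = assms(3)
  let ?M = "(op_abs T o\<^sub>L op_abs T) + (op_abs (adj S) o\<^sub>L op_abs (adj S))"
  define R where "R = 2 *\<^sub>R A - id_blinfun"
  have A: "positive_op A" and A_le: "positive_op (id_blinfun - A)"
    using assms(4) by (simp_all add: positive_contractive_def op_le_def)
  have "Re (cinner (A x) x) \<le> (norm x)\<^sup>2" for x
    using positive_op_Re_nonneg[OF A_le, of x]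
    by (simp add: blinfun.diff_left cinner_diff_left cinner_self)
  then have R: "norm R \<le> 1"
    unfolding R_def by (rule norm_reflection_le[OF A])
  have split: "S o\<^sub>L A o\<^sub>L T = (1 / 2) *\<^sub>R ((S o\<^sub>L R o\<^sub>L T) + (S o\<^sub>L T))"
    by (rule blinfun_eqI) (simp add: R_def blinfun.add_left blinfun.diff_left blinfun.scaleR_left
        blinfun.add_right blinfun.diff_right blinfun.scaleR_right)
  show ?num_SAT
  proof (rule numerical_radius_le)
    fix x :: 'a
    assume x: "norm x = 1"
    have "cinner ((S o\<^sub>L A o\<^sub>L T) x) x
        = (1 / 2) * cinner (S (R (T x))) x + (1 / 2) * cinner ((S o\<^sub>L T) x) x"
      unfolding split by (simp add: blinfun.add_left blinfun.scaleR_left cinner_simps)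
    then have "cmod (cinner ((S o\<^sub>L A o\<^sub>L T) x) x)
        \<le> 1 / 2 * cmod (cinner (S (R (T x))) x) + 1 / 2 * cmod (cinner ((S o\<^sub>L T) x) x)"
      using norm_triangle_ineq[of "(1 / 2) * cinner (S (R (T x))) x"
          "(1 / 2) * cinner ((S o\<^sub>L T) x) x"] by (simp add: norm_mult)
    then show "cmod (cinner ((S o\<^sub>L A o\<^sub>L T) x) x)
        \<le> 1 / 4 * norm ?M + 1 / 2 * numerical_radius (S o\<^sub>L T)"
      using cmod_cinner_sandwich_le[OF S T R x] numerical_radius_ge[OF x, of "S o\<^sub>L T"]
      by simp
  qed (simp add: numerical_radius_nonneg)
  show ?norm_SAT
  proof -
    have "norm (S o\<^sub>L R o\<^sub>L T) \<le> norm (S o\<^sub>L R) * norm T"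
      by (rule norm_blinfun_compose)
    also have "\<dots> \<le> (norm S * norm R) * norm T"
      by (intro mult_right_mono norm_blinfun_compose) simp
    also have "\<dots> \<le> (norm S * 1) * norm T"
      using R by (intro mult_right_mono mult_left_mono) auto
    finally have "norm (S o\<^sub>L R o\<^sub>L T) \<le> norm T * norm S"
      by (simp add: mult.commute)
    then show ?thesis
      unfolding split using norm_triangle_ineq[of "S o\<^sub>L R o\<^sub>L T" "S o\<^sub>L T"] by simp
  qed
  show ?num_ST
  proof (rule numerical_radius_le)
    show "cmod (cinner ((S o\<^sub>L T) x) x) \<le> 1 / 2 * norm ?M" if "norm x = 1" for x
      using cmod_cinner_sandwich_le[OF S T norm_blinfun_id_le that] by simp
  qed simp
qed

end
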